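(* Let $A:\mathbb{R}^p\to\mathbb{R}^d$ be linear, let $J:\mathbb{R}^p\to\mathbb{R}\cup\{+\infty\}$ be proper, convex and lower semicontinuous, and let $f\in\mathbb{R}^d$. Let $(\bar x,\bar y)\in\mathbb{R}^p\times\mathbb{R}^d$ satisfy $-A^*\bar y\in\partial J(\bar x)$ and $A\bar x=f$. Let $\delta\ge 0$ and let $f^\delta\in\mathbb{R}^d$ satisfy $\|f^\delta-f\|\le\delta$. Assume that for every $y\in\mathbb{R}^d$ the chain rule $\partial\left[J^\star(-A^*\cdot)\right](y)=-A\,\partial J^\star(-A^*y)$ holds. Let $(x(t),y(t))_{t\ge 0}$ be a solution of the dual subgradient flow $$x(t)\in\partial J^\star(-A^*y(t)),\qquad \dot y(t)=Ax(t)-f^\delta ,$$ and for $t>0$ set $\hat x(t):=\frac{2}{t}\int_{t/2}^{t}x(s)\,ds$. Then, with $C_0:=\|y(0)-\bar y\|$, the following hold for all $t>0$: $$D^{-A^*\bar y}(\hat x(t),\bar x)\le \frac{C_0^2}{t}+2C_0\delta+\delta^2 t,$$ $$\|A\hat x(t)-f\|^2\le \frac{2C_0^2}{t^2}+6C_0\frac{\delta}{t}+6\delta^2,$$ $$D^{-A^*y(t)}(\bar x,x(t))\le \frac{C_0^2}{2t}+\frac{3C_0}{2}\delta+\frac32\delta^2 t.$$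
   Context: Norms and inner products are Euclidean; $A^*$ is the adjoint of $A$; $J^\star(x):=\sup_{z\in\mathbb{R}^p}\langle x,z\rangle-J(z)$ is the Fenchel conjugate; $\partial$ denotes the convex subdifferential. For $u\in\partial J(x_2)$, the Bregman divergence is $D^{u}(x_1,x_2):=J(x_1)-J(x_2)-\langle u,x_1-x_2\rangle$. Note that $x(t)\in\partial J^\star(-A^*y(t))$ is equivalent to $-A^*y(t)\in\partial J(x(t))$, so $D^{-A^*y(t)}(\bar x,x(t))$ is meaningful. A solution of the dual subgradient flow is a pair $x:[0,\infty)\to\mathbb{R}^p$, $y:[0,\infty)\to\mathbb{R}^d$ such that: $y$ is Lipschitz continuous on $[0,\infty)$; $x(t)\in\partial J^\star(-A^*y(t))$ for all $t\ge0$ (in particular the function $\mathcal{D}_\delta(y):=J^\star(-A^*y)+\langle f^\delta,y\rangle$ has nonempty subdifferential at $y(t)$ for all $t\ge 0$, including the initial point $y(0)$); $\dot y(t)=Ax(t)-f^\delta$ for almost every $t\ge0$; and $x$ is measurable and integrable on bounded intervals, so that $\hat x(t)$ is defined. *)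

theory Defs
  imports "HOL-Analysis.Analysis"
begin

definition proper_fun :: "('a \<Rightarrow> ereal) \<Rightarrow> bool" where
  "proper_fun F \<longleftrightarrow> (\<forall>x. F x \<noteq> -\<infinity>) \<and> (\<exists>x. F x \<noteq> \<infinity>)"

text \<open>The library's \<open>convex_on\<close> is for real-valued functions only. The definition below is meant
  for functions that avoid \<open>-\<infinity>\<close>, so the right-hand side is never \<open>\<infinity> - \<infinity>\<close>; at the endpoints
  \<open>u = 0\<close> and \<open>u = 1\<close> the convention \<open>0 * \<infinity> = 0\<close> of \<open>ereal\<close> makes the inequality trivial.\<close>

definition convex_ereal :: "('a::real_vector \<Rightarrow> ereal) \<Rightarrow> bool" where
  "convex_ereal F \<longleftrightarrow> (\<forall>x z. \<forall>u\<in>{0..1}.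
     F (u *\<^sub>R x + (1 - u) *\<^sub>R z) \<le> ereal u * F x + ereal (1 - u) * F z)"

definition lower_semicontinuous :: "('a::topological_space \<Rightarrow> ereal) \<Rightarrow> bool" where
  "lower_semicontinuous F \<longleftrightarrow> (\<forall>x. F x \<le> Liminf (at x) F)"

definition fenchel_conj :: "('a::real_inner \<Rightarrow> ereal) \<Rightarrow> 'a \<Rightarrow> ereal" where
  "fenchel_conj J x = (SUP z. ereal (x \<bullet> z) - J z)"

text \<open>The subdifferential is empty wherever the function is not finite. For proper functions the
  finiteness condition is implied by the subgradient inequality.\<close>

definition subdifferential :: "('a::real_inner \<Rightarrow> ereal) \<Rightarrow> 'a \<Rightarrow> 'a set" where
  "subdifferential F x = {u. \<bar>F x\<bar> \<noteq> \<infinity> \<and> (\<forall>z. F x + ereal (u \<bullet> (z - x)) \<le> F z)}"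

text \<open>Only meaningful for \<open>u \<in> subdifferential J x\<^sub>2\<close>; then \<open>J x\<^sub>2\<close> is finite, and the value is
  \<open>\<infinity>\<close> exactly if \<open>J x\<^sub>1 = \<infinity>\<close>.\<close>

definition bregman :: "('a::real_inner \<Rightarrow> ereal) \<Rightarrow> 'a \<Rightarrow> 'a \<Rightarrow> 'a \<Rightarrow> ereal" where
  "bregman J u x\<^sub>1 x\<^sub>2 = J x\<^sub>1 - J x\<^sub>2 - ereal (u \<bullet> (x\<^sub>1 - x\<^sub>2))"

text \<open>Trajectories are functions on all of \<open>\<real>\<close>, but only their values on \<open>{0..}\<close> are constrained
  (hence the one-sided derivative at \<open>0\<close>, which is irrelevant almost everywhere).\<close>

definition dual_subgradient_flow ::
  "('a::euclidean_space \<Rightarrow> ereal) \<Rightarrow> ('a \<Rightarrow> 'b::euclidean_space) \<Rightarrow> 'b \<Rightarrow>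
     (real \<Rightarrow> 'a) \<Rightarrow> (real \<Rightarrow> 'b) \<Rightarrow> bool" where
  "dual_subgradient_flow J A g x y \<longleftrightarrow>
     (\<exists>L. L-lipschitz_on {0..} y) \<and>
     (\<forall>t\<ge>0. x t \<in> subdifferential (fenchel_conj J) (- adjoint A (y t))) \<and>
     (AE t in lebesgue. 0 \<le> t \<longrightarrow> (y has_vector_derivative (A (x t) - g)) (at t within {0..})) \<and>
     x \<in> borel_measurable (lebesgue_on {0..}) \<and>
     (\<forall>a b. 0 \<le> a \<longrightarrow> set_integrable lebesgue {a..b} x)"

definition tail_average :: "(real \<Rightarrow> 'a::euclidean_space) \<Rightarrow> real \<Rightarrow> 'a" where
  "tail_average x t = (2 / t) *\<^sub>R (LINT s:{t/2..t}|lebesgue. x s)"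

end

theory Submission
  imports Defs
begin

text \<open>
  The flow is the subgradient flow of the dual objective
  \<open>E y = J\<^sup>\<star>(- A\<^sup>* y) + \<langle>f\<^sub>\<delta>, y\<rangle>\<close>, because \<open>w = A x - f\<^sub>\<delta>\<close> is minus a subgradient of \<open>E\<close> along it.
  Put \<open>r = \<parallel>y - ybar\<parallel>\<close>. The Lyapunov function
  \<open>t (E (y t) - E ybar) + r\<^sup>2 / 2\<close> has derivative at most \<open>- t \<parallel>w t\<parallel>\<^sup>2\<close>. Since \<open>E (y t) - E ybar \<ge> - \<delta> r\<close>,
  this yields
  \<open>\<integral> s \<parallel>w s\<parallel>\<^sup>2 ds \<le> C\<^sub>0\<^sup>2 / 2 + \<delta>\<^sup>2 t\<^sup>2 / 2\<close> over \<open>[t/2, t]\<close>, which bounds the averaged residual by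
  Jensen, and a bound for the noise-free dual gap at \<open>y t\<close>, which equals the Bregman distance from
  \<open>x t\<close> to \<open>xbar\<close>. For the averaged primal iterate, \<open>J\<close> is replaced by its biconjugate
  (Fenchel-Moreau), so that Jensen's inequality reduces to integrating affine functions; the
  integrand is at most \<open>- (r\<^sup>2 / 2)' + \<delta> r\<close>, and \<open>r s \<le> C\<^sub>0 + \<delta> s\<close>.
\<close>

section \<open>The Fenchel-Moreau inequality\<close>

lemma lower_semicontinuous_eventually_gt:
  assumes "lower_semicontinuous F" and "c < F x"
  shows "\<forall>\<^sub>F z in nhds x. c < F z"
  using assms unfolding lower_semicontinuous_def le_Liminf_iff eventually_nhds_conv_at by blast

text \<open>The complement is open: for a real \<open>c\<close> strictly between \<open>r\<close>
  and \<open>F x\<close>, lower semicontinuity keeps \<open>F\<close> above \<open>c\<close> near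
  \<open>x\<close>, while heights near \<open>r\<close> stay below \<open>c\<close>.\<close>

lemma closed_epigraph:
  assumes "lower_semicontinuous F"
  shows "closed {(x, r::real). F x \<le> ereal r}"
proof -
  have "\<forall>\<^sub>F p in nhds (x, r). ereal (snd p) < F (fst p)" if less: "ereal r < F x" for x r
  proof -
    obtain c where c: "ereal r < ereal c" "ereal c < F x"
      using ereal_dense2[OF less] by blast
    have "\<forall>\<^sub>F z in nhds x. ereal c < F z"
      using assms c(2) by (rule lower_semicontinuous_eventually_gt)
    moreover have "\<forall>\<^sub>F s in nhds r. s < c"
      using c(1) by (intro eventually_nhds_in_open[of "{..<c}", simplified]) auto
    ultimately have "\<forall>\<^sub>F p in nhds x \<times>\<^sub>F nhds r. ereal c < F (fst p) \<and> snd p < c"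
      unfolding case_prod_beta[symmetric] by (intro eventually_prodI[where P = "\<lambda>z. ereal c < F z" and Q = "\<lambda>s. s < c"])
    then show ?thesis
      unfolding nhds_prod by eventually_elim (meson ereal_less_le less_ereal.simps(1) order.strict_trans)
  qed
  then have "open {p. ereal (snd p) < F (fst p)}"
    by (subst open_subopen) (force simp: eventually_nhds)
  moreover have "- {(x, r::real). F x \<le> ereal r} = {p. ereal (snd p) < F (fst p)}"
    by (auto simp: not_le)
  ultimately show ?thesis
    by (simp add: closed_def)
qed

lemma convex_epigraph:
  assumes "convex_ereal F"
  shows "convex {(x, r::real). F x \<le> ereal r}"
proof (rule convexI, clarsimp)
  fix x z and r s u v :: real
  assume F: "F x \<le> ereal r" "F z \<le> ereal s" and uv: "0 \<le> u" "0 \<le> v" "u + v = 1"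
  have v: "v = 1 - u"
    using uv by simp
  have "F (u *\<^sub>R x + v *\<^sub>R z) \<le> ereal u * F x + ereal v * F z"
    using assms uv unfolding convex_ereal_def v by auto
  also have "\<dots> \<le> ereal u * ereal r + ereal v * ereal s"
    using F uv by (intro add_mono ereal_mult_left_mono) auto
  finally show "F (u *\<^sub>R x + v *\<^sub>R z) \<le> ereal (u * r + v * s)"
    by simp
qed

text \<open>A point strictly below the graph is separated from the closed convex epigraph. Since the
  epigraph is unbounded upwards, \<open>b\<close> cannot be negative; \<open>b = 0\<close> can still
  occur when \<open>J x0\<close> is infinite.\<close>

lemma epigraph_separation:
  fixes J :: "'a::euclidean_space \<Rightarrow> ereal"
  assumes "proper_fun J" "convex_ereal J" "lower_semicontinuous J" and \<alpha>: "ereal \<alpha> < J x0"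
  obtains a b c where "0 \<le> b" "a \<bullet> x0 + b * \<alpha> < c" "\<And>x r. J x \<le> ereal r \<Longrightarrow> c < a \<bullet> x + b * r"
proof -
  obtain p c where p: "p \<bullet> (x0, \<alpha>) < c" "\<forall>q\<in>{(x, r::real). J x \<le> ereal r}. c < p \<bullet> q"
    using separating_hyperplane_closed_point[OF convex_epigraph[OF assms(2)] closed_epigraph[OF assms(3)],
        of "(x0, \<alpha>)"] \<alpha> by (auto simp: not_le)
  obtain a b where ab: "p = (a, b)"
    by (cases p)
  have sep: "c < a \<bullet> x + b * r" if "J x \<le> ereal r" for x r
    using p(2) that by (auto simp: ab)
  obtain x1 r1 where x1: "J x1 = ereal r1"
    using assms(1) unfolding proper_fun_def by (metis ereal_cases)
  have "0 \<le> b"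
  proof (rule ccontr)
    assume b: "\<not> 0 \<le> b"
    \<comment> \<open>This height above \<open>x1\<close> is large enough for the functional,
      decreasing in the height when \<open>b < 0\<close>, to have dropped to
      \<open>c\<close>.\<close>
    have "c < a \<bullet> x1 + b * max r1 ((c - a \<bullet> x1) / b)"
      by (rule sep) (simp add: x1)
    also have "\<dots> \<le> a \<bullet> x1 + b * ((c - a \<bullet> x1) / b)"
      using b by (intro add_left_mono mult_left_mono_neg) auto
    finally show False
      using b by simp
  qed
  then show thesis
    using that[of b a c] p(1) sep by (simp add: ab)
qed

text \<open>For \<open>b > 0\<close>, solving the hyperplane equation for the height gives an affine
  minorant. A vertical hyperplane has to be combined with such a minorant obtained at a point of the
  domain.\<close>

lemma affine_minorant_above:
  fixes J :: "'a::euclidean_space \<Rightarrow> ereal"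
  assumes J: "proper_fun J" "convex_ereal J" "lower_semicontinuous J" and \<alpha>: "ereal \<alpha> < J x0"
  obtains z k where "\<And>x. ereal (z \<bullet> x - k) \<le> J x" "\<alpha> \<le> z \<bullet> x0 - k"
proof -
  have nonvertical: "(\<forall>x. ereal ((- a /\<^sub>R b) \<bullet> x - (- c / b)) \<le> J x) \<and> \<beta> \<le> (- a /\<^sub>R b) \<bullet> x1 - (- c / b)"
    if "0 < b" "a \<bullet> x1 + b * \<beta> < c" and sep: "\<And>x r. J x \<le> ereal r \<Longrightarrow> c < a \<bullet> x + b * r" for a b c \<beta> x1
  proof (intro conjI allI)
    show "ereal ((- a /\<^sub>R b) \<bullet> x - (- c / b)) \<le> J x" for x
    proof (cases "J x")
      case (real r)
      then show ?thesis
        using sep[of x r] \<open>0 < b\<close> by (simp add: field_simps)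
    qed (use J(1) in \<open>auto simp: proper_fun_def\<close>)
    show "\<beta> \<le> (- a /\<^sub>R b) \<bullet> x1 - (- c / b)"
      using that by (simp add: field_simps)
  qed
  obtain x1 r1 where x1: "J x1 = ereal r1"
    using J(1) unfolding proper_fun_def by (metis ereal_cases)
  \<comment> \<open>Over a point of the domain the hyperplane cannot be vertical: it separates
    \<open>(x1, r1 - 1)\<close> from \<open>(x1, r1)\<close>, which differ only in height.\<close>
  obtain a1 b1 c1 where 1: "0 \<le> b1" "a1 \<bullet> x1 + b1 * (r1 - 1) < c1"
      "\<And>x r. J x \<le> ereal r \<Longrightarrow> c1 < a1 \<bullet> x + b1 * r"
    by (rule epigraph_separation[OF J, of "r1 - 1" x1]) (auto simp: x1)
  have "0 < b1"
    using 1(1) 1(2) 1(3)[of x1 r1] by (cases "b1 = 0") (auto simp: x1)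
  from nonvertical[OF this 1(2,3)] obtain z1 k1 where minorant: "\<And>x. ereal (z1 \<bullet> x - k1) \<le> J x"
    by blast
  obtain a b c where 2: "0 \<le> b" "a \<bullet> x0 + b * \<alpha> < c"
      "\<And>x r. J x \<le> ereal r \<Longrightarrow> c < a \<bullet> x + b * r"
    by (rule epigraph_separation[OF J \<alpha>]) blast
  show thesis
  proof (cases "b = 0")
    case False
    with 2(1) have "0 < b"
      by simp
    from nonvertical[OF this 2(2,3)] show thesis
      using that by blast
  next
    case True
    \<comment> \<open>A vertical hyperplane separates \<open>x0\<close> from the domain of \<open>J\<close>, so adding a large multiple of it
      tilts any affine minorant above \<open>\<alpha>\<close> at \<open>x0\<close>.\<close>
    define \<kappa> where "\<kappa> = max 0 ((\<alpha> - (z1 \<bullet> x0 - k1)) / (c - a \<bullet> x0))"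
    have pos: "0 < c - a \<bullet> x0"
      using 2(2) True by simp
    show thesis
    proof (rule that)
      show "ereal ((z1 - \<kappa> *\<^sub>R a) \<bullet> x - (k1 - \<kappa> * c)) \<le> J x" for x
      proof (cases "J x")
        case (real r)
        then have "c - a \<bullet> x \<le> 0"
          using 2(3)[of x r] True by simp
        then have "\<kappa> * (c - a \<bullet> x) \<le> 0"
          by (simp add: \<kappa>_def mult_nonneg_nonpos)
        then show ?thesis
          using minorant[of x] real by (simp add: algebra_simps)
      qed (use J(1) in \<open>auto simp: proper_fun_def\<close>)
      have "(\<alpha> - (z1 \<bullet> x0 - k1)) / (c - a \<bullet> x0) * (c - a \<bullet> x0) \<le> \<kappa> * (c - a \<bullet> x0)"
        using pos by (intro mult_right_mono) (auto simp: \<kappa>_def)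
      then have "\<alpha> - (z1 \<bullet> x0 - k1) \<le> \<kappa> * (c - a \<bullet> x0)"
        using pos by simp
      then show "\<alpha> \<le> (z1 - \<kappa> *\<^sub>R a) \<bullet> x0 - (k1 - \<kappa> * c)"
        by (simp add: algebra_simps)
    qed
  qed
qed

lemma fenchel_young: "ereal (\<xi> \<bullet> z) - J z \<le> fenchel_conj J \<xi>"
  unfolding fenchel_conj_def by (rule SUP_upper) simp

text \<open>An affine minorant of \<open>J\<close> with slope \<open>z\<close> and offset
  \<open>k\<close> forces \<open>fenchel_conj J z \<le> k\<close>, so the biconjugate dominates that
  minorant. Minorants reach every real level below \<open>J x\<close>.\<close>

theorem fenchel_moreau_le:
  fixes J :: "'a::euclidean_space \<Rightarrow> ereal"
  assumes "proper_fun J" "convex_ereal J" "lower_semicontinuous J"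
  shows "J x \<le> fenchel_conj (fenchel_conj J) x"
proof (rule ccontr)
  assume "\<not> ?thesis"
  then obtain \<alpha> where \<alpha>: "fenchel_conj (fenchel_conj J) x < ereal \<alpha>" "ereal \<alpha> < J x"
    using ereal_dense2[of "fenchel_conj (fenchel_conj J) x" "J x"] by (auto simp: not_le)
  obtain z k where minorant: "\<And>x. ereal (z \<bullet> x - k) \<le> J x" and above: "\<alpha> \<le> z \<bullet> x - k"
    using affine_minorant_above[OF assms \<alpha>(2)] by blast
  have "fenchel_conj J z \<le> ereal k"
    unfolding fenchel_conj_def
  proof (rule SUP_least)
    fix v show "ereal (z \<bullet> v) - J v \<le> ereal k"
      using minorant[of v] by (cases "J v") auto
  qed
  then have "ereal \<alpha> \<le> ereal (x \<bullet> z) - fenchel_conj J z"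
    using above by (cases "fenchel_conj J z") (auto simp: inner_commute)
  also have "\<dots> \<le> fenchel_conj (fenchel_conj J) x"
    by (rule fenchel_young)
  finally show False
    using \<alpha>(1) by simp
qed

text \<open>Equality case of Fenchel-Young: the subgradient inequality says that \<open>x\<close>
  attains the supremum.\<close>

lemma fenchel_conj_subgradient:
  assumes "u \<in> subdifferential J x"
  shows "fenchel_conj J u = ereal (u \<bullet> x) - J x"
proof (rule antisym)
  show "fenchel_conj J u \<le> ereal (u \<bullet> x) - J x"
    unfolding fenchel_conj_def
  proof (rule SUP_least)
    fix z
    have "J x + ereal (u \<bullet> (z - x)) \<le> J z" "\<bar>J x\<bar> \<noteq> \<infinity>"
      using assms by (auto simp: subdifferential_def)
    then show "ereal (u \<bullet> z) - J z \<le> ereal (u \<bullet> x) - J x"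
      by (cases "J x"; cases "J z") (auto simp: inner_diff_right)
  qed
qed (rule fenchel_young)

text \<open>A conjugate is a supremum of functions continuous in the slope, so upper bounds pass to
  the limit. This provides the assumption \<open>lsc\<close> of the locale below.\<close>

lemma fenchel_conj_limit_le:
  assumes "proper_fun J" and "\<xi> \<longlonglongrightarrow> l" and "c \<longlonglongrightarrow> d" and le: "\<And>n. fenchel_conj J (\<xi> n) \<le> ereal (c n)"
  shows "fenchel_conj J l \<le> ereal d"
  unfolding fenchel_conj_def
proof (rule SUP_least)
  fix z
  show "ereal (l \<bullet> z) - J z \<le> ereal d"
  proof (cases "J z")
    case (real r)
    have "\<xi> n \<bullet> z - r \<le> c n" for n
      using order_trans[OF fenchel_young le, of n z] real by simp
    moreover have "(\<lambda>n. \<xi> n \<bullet> z - r) \<longlonglongrightarrow> l \<bullet> z - r"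
      using assms(2) by (intro tendsto_intros)
    ultimately show ?thesis
      using assms(3) real by (auto intro: LIMSEQ_le)
  qed (use assms(1) in \<open>auto simp: proper_fun_def\<close>)
qed

section \<open>Integrating one-sided derivative bounds\<close>

lemma backward_difference_quotient_tendsto:
  fixes f :: "real \<Rightarrow> real"
  assumes "(f has_real_derivative D) (at x within {c..x})" and "c < x"
  shows "(\<lambda>n. (f x - f (x - 1 / Suc n)) / (1 / Suc n)) \<longlonglongrightarrow> D"
proof -
  have lim: "(\<lambda>n. x - 1 / Suc n) \<longlonglongrightarrow> x"
    using tendsto_diff[OF tendsto_const LIMSEQ_Suc[OF lim_1_over_n]] by fastforce
  then have "\<forall>\<^sub>F n in sequentially. x - 1 / Suc n > c"
    using assms(2) by (simp add: order_tendstoD)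
  then have "\<forall>\<^sub>F n in sequentially. x - 1 / Suc n \<in> {c..x} \<and> x - 1 / Suc n \<noteq> x"
    by eventually_elim auto
  then have "filterlim (\<lambda>n. x - 1 / Suc n) (at x within {c..x}) sequentially"
    using lim by (auto simp: filterlim_at)
  then have "(\<lambda>n. (f (x - 1 / Suc n) - f x) / ((x - 1 / Suc n) - x)) \<longlonglongrightarrow> D"
    using assms(1) filterlim_compose unfolding has_field_derivative_iff by blast
  then show ?thesis
    by (simp add: field_simps)
qed

text \<open>The function \<open>G\<close> touches \<open>F\<close> from below at \<open>t\<close>, so \<open>F\<close> itself need not be known to be
  differentiable anywhere. The proof passes to the limit in the backward difference quotients of
  \<open>F\<close> by dominated convergence.\<close>

lemma lipschitz_increment_le_integral:
  fixes F g :: "real \<Rightarrow> real"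
  assumes ab: "a \<le> b" and lip: "L-lipschitz_on {a..b} F"
    and g: "integrable (lebesgue_on {a..b}) g"
    and supp: "AE t in lebesgue_on {a..b}. a < t \<longrightarrow>
      (\<exists>G d. G t = F t \<and> (\<forall>s\<in>{a..t}. G s \<le> F s) \<and>
        (G has_real_derivative d) (at t within {a..t}) \<and> d \<le> g t)"
  shows "F b - F a \<le> (LINT t|lebesgue_on {a..b}. g t)"
proof -
  define h where "h n = 1 / real (Suc n)" for n
  have h: "0 < h n" "h n \<le> 1" for n
    by (auto simp: h_def)
  \<comment> \<open>Constant extension to the left of \<open>a\<close>, with the same Lipschitz
    constant, so that backward quotients make sense on all of \<open>{a..b}\<close>.\<close>
  define Ft where "Ft s = F (max a s)" for s
  have L: "0 \<le> L"
    using lip lipschitz_on_nonneg by blast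
  have Ft_lip: "\<bar>Ft s - Ft t\<bar> \<le> L * \<bar>s - t\<bar>" if "s \<le> b" "t \<le> b" for s t
  proof -
    have "\<bar>Ft s - Ft t\<bar> \<le> L * \<bar>max a s - max a t\<bar>"
      using lipschitz_onD[OF lip, of "max a s" "max a t"] that ab by (auto simp: Ft_def dist_real_def)
    also have "\<dots> \<le> L * \<bar>s - t\<bar>"
      using L by (intro mult_left_mono) auto
    finally show ?thesis .
  qed
  have "L-lipschitz_on {..b} Ft"
    using L Ft_lip by (intro lipschitz_onI) (auto simp: dist_real_def)
  then have Ft_cont: "continuous_on {..b} Ft"
    by (rule lipschitz_on_continuous_on)
  define q where "q n t = (Ft t - Ft (t - h n)) / h n" for n t
  have q_cont: "continuous_on {a..b} (q n)" for n
    unfolding q_def using h[of n]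
    by (intro continuous_intros continuous_on_compose2[OF Ft_cont]) (auto intro: add_increasing2 simp: diff_le_eq)
  have q_int: "integrable (lebesgue_on {a..b}) (q n)" for n
    using q_cont by (intro continuous_imp_integrable_real)
  have q_bound: "\<bar>q n t\<bar> \<le> L" if "t \<in> {a..b}" for n t
    using Ft_lip[of t "t - h n"] h[of n] that by (auto simp: q_def divide_simps mult.commute)
  \<comment> \<open>The base point \<open>a - 1\<close> leaves room for the shift, as
    \<open>h n \<le> 1\<close>.\<close>
  define I where "I u = integral {a - 1..u} Ft" for u
  have Ft_integrable: "Ft integrable_on {c..d}" if "d \<le> b" for c d
    using that by (intro integrable_continuous_real continuous_on_subset[OF Ft_cont]) auto
  have I_diff: "integral {c..d} Ft = I d - I c" if "a - 1 \<le> c" "c \<le> d" "d \<le> b" for c d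
    using Henstock_Kurzweil_Integration.integral_combine[of "a - 1" c d Ft] Ft_integrable that
    by (simp add: I_def)
  have I_deriv: "(\<lambda>n. (I u - I (u - h n)) / h n) \<longlonglongrightarrow> Ft u" if "a \<le> u" "u \<le> b" for u
  proof -
    have "(I has_real_derivative Ft u) (at u within {a - 1..u})"
      unfolding I_def using that
      by (intro integral_has_real_derivative continuous_on_subset[OF Ft_cont]) auto
    from backward_difference_quotient_tendsto[OF this] show ?thesis
      using that by (simp add: h_def)
  qed
  \<comment> \<open>The integrated quotient telescopes to backward quotients of the primitive
    \<open>I\<close> at the two endpoints, and these converge because \<open>Ft\<close> is
    continuous.\<close>
  have q_integral: "(LINT t|lebesgue_on {a..b}. q n t) = (I b - I (b - h n)) / h n - (I a - I (a - h n)) / h n" for n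
  proof -
    have "(LINT t|lebesgue_on {a..b}. q n t) = integral {a..b} (q n)"
      using q_int by (intro lebesgue_integral_eq_integral) auto
    also have "\<dots> = integral {a..b} (\<lambda>t. Ft t - Ft (t - h n)) / h n"
      unfolding q_def by (simp add: divide_inverse)
    also have "integral {a..b} (\<lambda>t. Ft t - Ft (t - h n)) = integral {a..b} Ft - integral {a..b} (\<lambda>t. Ft (t - h n))"
    proof (rule integral_diff)
      show "Ft integrable_on {a..b}"
        by (rule Ft_integrable) simp
      show "(\<lambda>t. Ft (t - h n)) integrable_on {a..b}"
        using h[of n] by (intro integrable_continuous_real continuous_on_compose2[OF Ft_cont] continuous_intros)
          (auto simp: diff_le_eq intro: add_increasing2)
    qed
    also have "integral {a..b} (\<lambda>t. Ft (t - h n)) = integral {a - h n..b - h n} Ft"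
      using integral_shift[of a "- h n" b Ft] continuous_on_subset[OF Ft_cont, of "{a - h n..b - h n}"] h[of n]
      by (force simp: o_def)
    also have "integral {a..b} Ft = I b - I a"
      using ab by (intro I_diff) auto
    also have "integral {a - h n..b - h n} Ft = I (b - h n) - I (a - h n)"
      using ab h[of n] by (intro I_diff) auto
    finally show ?thesis
      by (simp add: diff_divide_distrib)
  qed
  have "(\<lambda>n. LINT t|lebesgue_on {a..b}. q n t) \<longlonglongrightarrow> Ft b - Ft a"
    unfolding q_integral using ab by (intro tendsto_diff I_deriv) auto
  then have q_lim: "(\<lambda>n. LINT t|lebesgue_on {a..b}. q n t) \<longlonglongrightarrow> F b - F a"
    using ab by (simp add: Ft_def)
  \<comment> \<open>Only the excess of \<open>q n\<close> over \<open>g\<close> has to vanish. Where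
    \<open>G\<close> touches \<open>F\<close> from below, the backward quotient of \<open>F\<close>
    is at most that of \<open>G\<close>, whose limit is \<open>d \<le> g t\<close>.\<close>
  define u where "u n t = max 0 (q n t - g t)" for n t
  have u_int: "integrable (lebesgue_on {a..b}) (u n)" for n
    unfolding u_def by (intro integrable_max Bochner_Integration.integrable_diff q_int g) auto
  have "AE t in lebesgue_on {a..b}. t \<noteq> a"
    using AE_completion[OF AE_lborel_singleton[of a]] by (auto simp: AE_restrict_space_iff elim: eventually_mono)
  then have u_lim: "AE t in lebesgue_on {a..b}. (\<lambda>n. u n t) \<longlonglongrightarrow> 0"
    using supp AE_space
  proof eventually_elim
    case (elim t)
    then have t: "a < t" "t \<le> b"
      by auto
    then obtain G d where G: "G t = F t" "\<And>s. s \<in> {a..t} \<Longrightarrow> G s \<le> F s"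
        "(G has_real_derivative d) (at t within {a..t})" "d \<le> g t"
      using elim by blast
    have Glim: "(\<lambda>n. (G t - G (t - h n)) / h n) \<longlonglongrightarrow> d"
      using backward_difference_quotient_tendsto[OF G(3) t(1)] by (simp add: h_def)
    have Glim: "(\<lambda>n. max 0 ((G t - G (t - h n)) / h n - d)) \<longlonglongrightarrow> 0"
      using tendsto_max[OF tendsto_const tendsto_diff[OF Glim tendsto_const], of 0 d] by simp
    have "(\<lambda>n. t - h n) \<longlonglongrightarrow> t"
      using tendsto_diff[OF tendsto_const LIMSEQ_Suc[OF lim_1_over_n]] unfolding h_def by fastforce
    then have "\<forall>\<^sub>F n in sequentially. t - h n > a"
      using t by (simp add: order_tendstoD)
    then have upper: "\<forall>\<^sub>F n in sequentially. u n t \<le> max 0 ((G t - G (t - h n)) / h n - d)"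
    proof eventually_elim
      case (elim n)
      have "q n t \<le> (G t - G (t - h n)) / h n"
        unfolding q_def Ft_def using G(1) G(2)[of "t - h n"] elim h[of n] t
        by (intro divide_right_mono) auto
      then show ?case
        using G(4) by (auto simp: u_def)
    qed
    have "\<forall>\<^sub>F n in sequentially. 0 \<le> u n t"
      by (simp add: u_def)
    then show ?case
      by (rule tendsto_sandwich[OF _ upper tendsto_const Glim])
  qed
  have "(\<lambda>n. LINT t|lebesgue_on {a..b}. u n t) \<longlonglongrightarrow> (LINT t|lebesgue_on {a..b}. 0)"
  proof (rule integral_dominated_convergence[where w="\<lambda>t. L + \<bar>g t\<bar>"])
    show "integrable (lebesgue_on {a..b}) (\<lambda>t. L + \<bar>g t\<bar>)"
      by (intro Bochner_Integration.integrable_add integrable_abs g continuous_imp_integrable_real continuous_intros)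
    show "AE t in lebesgue_on {a..b}. norm (u n t) \<le> L + \<bar>g t\<bar>" for n
    proof (intro AE_I2)
      fix t assume "t \<in> space (lebesgue_on {a..b})"
      then show "norm (u n t) \<le> L + \<bar>g t\<bar>"
        using q_bound[of t n] by (auto simp: u_def)
    qed
  qed (use u_int u_lim in auto)
  then have "(\<lambda>n. (LINT t|lebesgue_on {a..b}. g t) + (LINT t|lebesgue_on {a..b}. u n t))
      \<longlonglongrightarrow> (LINT t|lebesgue_on {a..b}. g t) + 0"
    by (intro tendsto_add) auto
  moreover have "(LINT t|lebesgue_on {a..b}. q n t) \<le> (LINT t|lebesgue_on {a..b}. g t) + (LINT t|lebesgue_on {a..b}. u n t)" for n
    unfolding Bochner_Integration.integral_add[OF g u_int, symmetric]
    by (intro integral_mono q_int Bochner_Integration.integrable_add g u_int) (auto simp: u_def)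
  ultimately show ?thesis
    using q_lim LIMSEQ_le by fastforce
qed

section \<open>Curves driven by subgradients\<close>

text \<open>Both factors are bounded on a compact set. This makes the products in the Lyapunov
  functions below Lipschitz, as the increment lemma demands.\<close>

lemma lipschitz_on_inner_compact:
  fixes f g :: "'a::metric_space \<Rightarrow> 'b::real_inner"
  assumes "compact S" and f: "L-lipschitz_on S f" and g: "M-lipschitz_on S g"
  obtains K where "K-lipschitz_on S (\<lambda>s. f s \<bullet> g s)"
proof -
  have "bounded (f ` S)" "bounded (g ` S)"
    using compact_continuous_image[OF lipschitz_on_continuous_on[OF f] assms(1)]
      compact_continuous_image[OF lipschitz_on_continuous_on[OF g] assms(1)]
    by (simp_all add: compact_imp_bounded)
  then obtain B C where B: "0 < B" "\<And>s. s \<in> S \<Longrightarrow> norm (f s) \<le> B"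
      and C: "0 < C" "\<And>s. s \<in> S \<Longrightarrow> norm (g s) \<le> C"
    unfolding bounded_pos by auto
  have LM: "0 \<le> L" "0 \<le> M"
    using f g lipschitz_on_nonneg by auto
  have "(B * M + L * C)-lipschitz_on S (\<lambda>s. f s \<bullet> g s)"
  proof (rule lipschitz_onI)
    fix s t assume st: "s \<in> S" "t \<in> S"
    have "dist (f s \<bullet> g s) (f t \<bullet> g t) = \<bar>f s \<bullet> (g s - g t) + (f s - f t) \<bullet> g t\<bar>"
      by (simp add: dist_real_def inner_diff_left inner_diff_right)
    also have "\<dots> \<le> norm (f s) * norm (g s - g t) + norm (f s - f t) * norm (g t)"
      using Cauchy_Schwarz_ineq2[of "f s" "g s - g t"] Cauchy_Schwarz_ineq2[of "f s - f t" "g t"] by linarith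
    also have "\<dots> \<le> B * (M * dist s t) + (L * dist s t) * C"
      using lipschitz_onD[OF f st] lipschitz_onD[OF g st] B(1) B(2)[OF st(1)] C(2)[OF st(2)] LM
      by (intro add_mono mult_mono) (simp_all add: dist_norm)
    finally show "dist (f s \<bullet> g s) (f t \<bullet> g t) \<le> (B * M + L * C) * dist s t"
      by (simp add: algebra_simps)
  qed (use LM B C in auto)
  then show thesis
    by (rule that)
qed

lemma inner_sgn: "v \<bullet> sgn v = norm v"
  for v :: "'a::real_inner"
  by (cases "v = 0") (simp_all add: sgn_div_norm dot_square_norm power2_eq_square)

text \<open>\<open>\<Phi> t\<close> stands for \<open>E (y t)\<close> with \<open>E\<close> convex and lower semicontinuous and \<open>- w t\<close> a subgradient of
  \<open>E\<close> at \<open>y t\<close>; only the values of \<open>E\<close> along the curve matter, and these are finite.\<close>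

locale subgradient_curve =
  fixes y w :: "real \<Rightarrow> 'b::euclidean_space" and \<Phi> :: "real \<Rightarrow> real" and L :: real
  assumes lip: "L-lipschitz_on {0..} y"
    and deriv: "AE t in lebesgue. 0 \<le> t \<longrightarrow> (y has_vector_derivative w t) (at t within {0..})"
    and meas: "w \<in> borel_measurable (lebesgue_on {0..})"
    and subgradient: "\<lbrakk>0 \<le> t; 0 \<le> s\<rbrakk> \<Longrightarrow> \<Phi> t - w t \<bullet> (y s - y t) \<le> \<Phi> s"
    and lsc: "\<lbrakk>0 \<le> t; \<And>n. 0 \<le> \<tau> n; \<tau> \<longlonglongrightarrow> t; c \<longlonglongrightarrow> d; \<And>n. \<Phi> (\<tau> n) \<le> c n\<rbrakk> \<Longrightarrow> \<Phi> t \<le> d"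
begin

lemma L_nonneg: "0 \<le> L"
  using lip lipschitz_on_nonneg by blast

text \<open>Testing against \<open>sgn (w t)\<close> turns the claim into a bound on scalar
  difference quotients of \<open>y\<close>.\<close>

lemma norm_derivative_le:
  assumes t: "0 \<le> t" and "(y has_vector_derivative w t) (at t within {0..})"
  shows "norm (w t) \<le> L"
proof -
  have "((\<lambda>s. y s \<bullet> sgn (w t)) has_real_derivative w t \<bullet> sgn (w t)) (at t within {0..})"
    using bounded_linear.has_vector_derivative[OF bounded_linear_inner_left assms(2)]
    by (simp add: has_real_derivative_iff_has_vector_derivative)
  then have lim: "((\<lambda>s. (y s \<bullet> sgn (w t) - y t \<bullet> sgn (w t)) / (s - t)) \<longlongrightarrow> norm (w t)) (at t within {0..})"
    by (simp add: has_field_derivative_iff inner_sgn)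
  have "\<forall>\<^sub>F s in at t within {0..}. (y s \<bullet> sgn (w t) - y t \<bullet> sgn (w t)) / (s - t) \<le> L"
    unfolding eventually_at_filter
  proof (intro always_eventually allI impI)
    fix s :: real assume s: "s \<noteq> t" "s \<in> {0..}"
    have "\<bar>(y s - y t) \<bullet> sgn (w t)\<bar> \<le> norm (y s - y t) * norm (sgn (w t))"
      by (rule Cauchy_Schwarz_ineq2)
    also have "\<dots> \<le> norm (y s - y t) * 1"
      by (intro mult_left_mono) (auto simp: norm_sgn)
    also have "\<dots> \<le> L * \<bar>s - t\<bar>"
      using lipschitz_on_normD[OF lip, of s t] s t by simp
    finally have "\<bar>(y s - y t) \<bullet> sgn (w t) / (s - t)\<bar> \<le> L"
      using s by (simp add: field_simps)
    then show "(y s \<bullet> sgn (w t) - y t \<bullet> sgn (w t)) / (s - t) \<le> L"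
      by (metis abs_le_D1 inner_diff_left)
  qed
  moreover have "at t within {0..} \<noteq> bot"
    using at_le[of "{t<..}" "{0..}" t] t trivial_limit_at_right_real[of t]
    by (metis atLeast_iff greaterThan_iff le_bot less_imp_le order_trans subsetI)
  ultimately show ?thesis
    using lim tendsto_upperbound by blast
qed

lemma AE_derivative:
  assumes "0 \<le> a"
  shows "AE t in lebesgue_on {a..b}. (y has_vector_derivative w t) (at t within {a..t}) \<and> norm (w t) \<le> L"
proof -
  have "AE t in lebesgue. t \<in> {a..b} \<longrightarrow> (y has_vector_derivative w t) (at t within {a..t}) \<and> norm (w t) \<le> L"
    using deriv
  proof eventually_elim
    case (elim t)
    show ?case
    proof
      assume t: "t \<in> {a..b}"
      with elim assms have d: "(y has_vector_derivative w t) (at t within {0..})"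
        by simp
      then show "(y has_vector_derivative w t) (at t within {a..t}) \<and> norm (w t) \<le> L"
        using norm_derivative_le[OF _ d] t assms by (auto intro: has_vector_derivative_within_subset)
    qed
  qed
  then show ?thesis
    by (subst AE_restrict_space_iff) simp_all
qed

text \<open>An interval of positive length is not a null set, so it meets the set of times where the
  derivative exists.\<close>

lemma exists_good_time:
  assumes "0 \<le> t" and "0 < e"
  obtains s where "t < s" "s < t + e" "norm (w s) \<le> L"
proof -
  have "\<exists>s\<in>{t<..<t + e}. 0 \<le> s \<longrightarrow> (y has_vector_derivative w s) (at s within {0..})"
  proof (rule ccontr)
    assume none: "\<not> ?thesis"
    have "{t<..<t + e} \<in> null_sets lebesgue"
    proof (rule null_setsI)
      have "AE s in lebesgue. s \<notin> {t<..<t + e}"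
        using deriv by eventually_elim (use none in blast)
      then show "emeasure lebesgue {t<..<t + e} = 0"
        by (subst (asm) AE_iff_measurable[where N = "{t<..<t + e}"]) auto
    qed simp
    then show False
      using assms by (simp add: null_sets_def)
  qed
  then show thesis
    using that norm_derivative_le assms(1) by force
qed

lemma energy_le:
  assumes "0 \<le> t" "0 \<le> s" "norm (w t) \<le> L"
  shows "\<Phi> t \<le> \<Phi> s + L * L * \<bar>s - t\<bar>"
proof -
  have "\<bar>w t \<bullet> (y s - y t)\<bar> \<le> norm (w t) * norm (y s - y t)"
    by (rule Cauchy_Schwarz_ineq2)
  also have "\<dots> \<le> L * (L * \<bar>s - t\<bar>)"
    using assms lipschitz_on_normD[OF lip, of s t] L_nonneg by (intro mult_mono) auto
  finally show ?thesis
    using subgradient[OF assms(1,2)] by (simp add: mult.assoc)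
qed

text \<open>The bound on \<open>w\<close> may fail on a null set, so \<open>energy_le\<close> is
  available only at good times. Each \<open>t\<close> is a limit of good times from the right, and
  lower semicontinuity carries the upper bound over to \<open>\<Phi> t\<close>.\<close>

lemma energy_lipschitz: "(L * L)-lipschitz_on {0..} \<Phi>"
proof -
  have le: "\<Phi> t \<le> \<Phi> s + L * L * \<bar>s - t\<bar>" if "0 \<le> t" "0 \<le> s" for s t
  proof -
    have "\<exists>\<tau>>t. \<tau> < t + 1 / Suc n \<and> norm (w \<tau>) \<le> L" for n
      using exists_good_time[OF \<open>0 \<le> t\<close>, of "1 / Suc n"] by auto
    then obtain \<tau> where \<tau>: "\<And>n. t < \<tau> n" "\<And>n. \<tau> n < t + 1 / Suc n" "\<And>n. norm (w (\<tau> n)) \<le> L"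
      by metis
    have "(\<lambda>n. t + 1 / Suc n) \<longlonglongrightarrow> t"
      using tendsto_add[OF tendsto_const LIMSEQ_Suc[OF lim_1_over_n]] by fastforce
    then have lim: "\<tau> \<longlonglongrightarrow> t"
      by (rule tendsto_sandwich[OF _ _ tendsto_const, rotated 2])
         (use \<tau> in \<open>auto intro!: always_eventually less_imp_le\<close>)
    show ?thesis
    proof (rule lsc[OF \<open>0 \<le> t\<close> _ lim])
      show "0 \<le> \<tau> n" for n
        using \<tau>(1)[of n] that by linarith
      then show "\<Phi> (\<tau> n) \<le> \<Phi> s + L * L * \<bar>s - \<tau> n\<bar>" for n
        using energy_le \<tau>(3) that by blast
      show "(\<lambda>n. \<Phi> s + L * L * \<bar>s - \<tau> n\<bar>) \<longlonglongrightarrow> \<Phi> s + L * L * \<bar>s - t\<bar>"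
        using lim by (intro tendsto_intros)
    qed
  qed
  show ?thesis
  proof (rule lipschitz_onI)
    fix s t :: real assume "s \<in> {0..}" "t \<in> {0..}"
    then show "dist (\<Phi> s) (\<Phi> t) \<le> L * L * dist s t"
      using le[of s t] le[of t s] by (simp add: dist_real_def abs_minus_commute)
  qed (simp add: L_nonneg)
qed

lemma derivative_measurable:
  assumes "0 \<le> a" shows "w \<in> borel_measurable (lebesgue_on {a..b})"
  by (rule measurable_restrict_mono[OF meas]) (use assms in auto)

lemma integrable_derivative_product:
  assumes "0 \<le> a" and v: "continuous_on {a..b} v"
  shows "integrable (lebesgue_on {a..b}) (\<lambda>s. w s \<bullet> v s)"
proof -
  obtain B where B: "0 < B" "\<And>s. s \<in> {a..b} \<Longrightarrow> norm (v s) \<le> B"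
    using compact_imp_bounded[OF compact_continuous_image[OF v compact_Icc]] unfolding bounded_pos by auto
  show ?thesis
  proof (rule Bochner_Integration.integrable_bound)
    show "integrable (lebesgue_on {a..b}) (\<lambda>s. L * B)"
      by (intro continuous_imp_integrable_real continuous_intros)
    show "(\<lambda>s. w s \<bullet> v s) \<in> borel_measurable (lebesgue_on {a..b})"
      using derivative_measurable[OF assms(1)] continuous_imp_measurable_on_sets_lebesgue[OF v]
      by (intro borel_measurable_inner) auto
    show "AE s in lebesgue_on {a..b}. norm (w s \<bullet> v s) \<le> norm (L * B)"
      using AE_derivative[OF assms(1), of b] AE_space
    proof eventually_elim
      case (elim s)
      have "norm (w s \<bullet> v s) \<le> norm (w s) * norm (v s)"
        by (simp add: Cauchy_Schwarz_ineq2)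
      also have "\<dots> \<le> L * B"
        using elim B L_nonneg by (intro mult_mono) auto
      finally show ?case
        by simp
    qed
  qed
qed

lemma integrable_weighted_speed:
  assumes "0 \<le> a"
  shows "integrable (lebesgue_on {a..b}) (\<lambda>s. s * (norm (w s))\<^sup>2)"
proof (rule Bochner_Integration.integrable_bound)
  show "integrable (lebesgue_on {a..b}) (\<lambda>s. b * L\<^sup>2)"
    by (intro continuous_imp_integrable_real continuous_intros)
  show "(\<lambda>s. s * (norm (w s))\<^sup>2) \<in> borel_measurable (lebesgue_on {a..b})"
    using derivative_measurable[OF assms(1)] continuous_imp_measurable_on_sets_lebesgue[OF continuous_on_id, of "{a..b}"]
    by (intro borel_measurable_times borel_measurable_power borel_measurable_norm) auto
  show "AE s in lebesgue_on {a..b}. norm (s * (norm (w s))\<^sup>2) \<le> norm (b * L\<^sup>2)"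
    using AE_derivative[OF assms(1), of b] AE_space
  proof eventually_elim
    case (elim s)
    then have "s * (norm (w s))\<^sup>2 \<le> b * L\<^sup>2"
      using assms by (intro mult_mono power_mono) auto
    then show ?case
      using elim assms by simp
  qed
qed

text \<open>Formally \<open>\<Phi>\<close> has derivative \<open>- (norm (w s))\<^sup>2\<close>, and
  the remaining part \<open>\<Phi> s - D + w s \<bullet> (y s - v)\<close> of the derivative is
  nonpositive by the hypothesis, the subgradient inequality at \<open>v\<close> with
  \<open>D\<close> as the value there.\<close>

lemma lyapunov_decrease:
  assumes ab: "0 \<le> a" "a \<le> b" and v: "\<And>s. 0 \<le> s \<Longrightarrow> \<Phi> s - w s \<bullet> (v - y s) \<le> D"
  shows "b * (\<Phi> b - D) + (norm (y b - v))\<^sup>2 / 2 + (LINT s|lebesgue_on {a..b}. s * (norm (w s))\<^sup>2)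
    \<le> a * (\<Phi> a - D) + (norm (y a - v))\<^sup>2 / 2"
proof -
  have sub: "{a..b} \<subseteq> {0..}"
    using ab by auto
  \<comment> \<open>The product of reals is written as an inner product to match
    \<open>lipschitz_on_inner_compact\<close>.\<close>
  define F where "F s = s \<bullet> (\<Phi> s - D) + (1/2) * ((y s - v) \<bullet> (y s - v))" for s
  have ylip: "(L + 0)-lipschitz_on {a..b} (\<lambda>s. y s - v)"
    by (intro lipschitz_intros lipschitz_on_subset[OF lip sub])
  have \<Phi>lip: "(L * L + 0)-lipschitz_on {a..b} (\<lambda>s. \<Phi> s - D)"
    by (intro lipschitz_intros lipschitz_on_subset[OF energy_lipschitz sub])
  obtain K1 where K1: "K1-lipschitz_on {a..b} (\<lambda>s. s \<bullet> (\<Phi> s - D))"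
    using lipschitz_on_inner_compact[OF compact_Icc lipschitz_on_id \<Phi>lip] by blast
  obtain K2 where K2: "K2-lipschitz_on {a..b} (\<lambda>s. (y s - v) \<bullet> (y s - v))"
    using lipschitz_on_inner_compact[OF compact_Icc ylip ylip] by blast
  have Flip: "(K1 + \<bar>1/2\<bar> * K2)-lipschitz_on {a..b} F"
    unfolding F_def by (intro lipschitz_on_add K1 lipschitz_on_cmult_real K2)
  have "F b - F a \<le> (LINT s|lebesgue_on {a..b}. - (s * (norm (w s))\<^sup>2))"
  proof (rule lipschitz_increment_le_integral[OF ab(2) Flip])
    show "integrable (lebesgue_on {a..b}) (\<lambda>s. - (s * (norm (w s))\<^sup>2))"
      using integrable_weighted_speed[OF ab(1)] by simp
    show "AE t in lebesgue_on {a..b}. a < t \<longrightarrow>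
      (\<exists>G d. G t = F t \<and> (\<forall>s\<in>{a..t}. G s \<le> F s) \<and>
        (G has_real_derivative d) (at t within {a..t}) \<and> d \<le> - (t * (norm (w t))\<^sup>2))"
      using AE_derivative[OF ab(1), of b] AE_space
    proof eventually_elim
      case (elim t)
      then have t: "0 \<le> t" and der: "(y has_vector_derivative w t) (at t within {a..t})"
        using ab by auto
      \<comment> \<open>\<open>\<Phi>\<close> is replaced by its subgradient minorant at time
        \<open>t\<close>, which is differentiable along the curve; the factor
        \<open>s \<ge> 0\<close> preserves the inequality.\<close>
      define G where "G s = s * (\<Phi> t - w t \<bullet> (y s - y t) - D) + (1/2) * ((y s - v) \<bullet> (y s - v))" for s
      have "(G has_real_derivative (\<Phi> t - D - t * (w t \<bullet> w t) + w t \<bullet> (y t - v))) (at t within {a..t})"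
        using der unfolding G_def has_real_derivative_iff_has_vector_derivative has_vector_derivative_def
        by (auto intro!: derivative_eq_intros simp: algebra_simps inner_commute)
      moreover have "\<Phi> t - D - t * (w t \<bullet> w t) + w t \<bullet> (y t - v) \<le> - (t * (norm (w t))\<^sup>2)"
        using v[OF t] by (simp add: power2_norm_eq_inner inner_diff_right)
      moreover have "G s \<le> F s" if "s \<in> {a..t}" for s
        using that ab subgradient[OF t, of s] unfolding G_def F_def
        by (auto intro!: mult_left_mono)
      moreover have "G t = F t"
        by (simp add: G_def F_def)
      ultimately show ?case
        by blast
    qed
  qed
  then show ?thesis
    by (simp add: F_def power2_norm_eq_inner)
qed

text \<open>Dividing the hypothesis by the distance bounds the radial velocity by
  \<open>\<delta>\<close>.\<close>

lemma distance_growth: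
  assumes "0 \<le> a" "a \<le> b" "0 \<le> \<delta>" and v: "\<And>s. 0 \<le> s \<Longrightarrow> w s \<bullet> (y s - v) \<le> \<delta> * norm (y s - v)"
  shows "norm (y b - v) \<le> norm (y a - v) + \<delta> * (b - a)"
proof -
  have "L-lipschitz_on {a..b} (\<lambda>s. norm (y s - v))"
  proof (rule lipschitz_onI)
    fix s t assume "s \<in> {a..b}" "t \<in> {a..b}"
    then show "dist (norm (y s - v)) (norm (y t - v)) \<le> L * dist s t"
      using lipschitz_on_normD[OF lip, of s t] norm_triangle_ineq3[of "y s - v" "y t - v"] assms(1)
      by (simp add: dist_real_def)
  qed (rule L_nonneg)
  then have "norm (y b - v) - norm (y a - v) \<le> (LINT t|lebesgue_on {a..b}. \<delta>)"
  proof (rule lipschitz_increment_le_integral[OF assms(2)])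
    show "integrable (lebesgue_on {a..b}) (\<lambda>t. \<delta>)"
      by (intro continuous_imp_integrable_real continuous_intros)
    show "AE t in lebesgue_on {a..b}. a < t \<longrightarrow>
      (\<exists>G d. G t = norm (y t - v) \<and> (\<forall>s\<in>{a..t}. G s \<le> norm (y s - v)) \<and>
        (G has_real_derivative d) (at t within {a..t}) \<and> d \<le> \<delta>)"
      using AE_derivative[OF assms(1), of b] AE_space
    proof eventually_elim
      case (elim t)
      then have t: "0 \<le> t" and der: "(y has_vector_derivative w t) (at t within {a..t})"
        using assms by auto
      \<comment> \<open>The norm is touched from below by the linear functional in direction \<open>e\<close>, also where it
        is not differentiable.\<close>
      define e where "e = sgn (y t - v)"
      have e: "norm e \<le> 1"
        by (simp add: e_def norm_sgn)
      have "((\<lambda>s. (y s - v) \<bullet> e) has_real_derivative w t \<bullet> e) (at t within {a..t})"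
        using der unfolding has_real_derivative_iff_has_vector_derivative has_vector_derivative_def
        by (auto intro!: derivative_eq_intros simp: algebra_simps)
      moreover have "w t \<bullet> e \<le> \<delta>"
        using v[OF t] assms(3) by (cases "y t = v") (auto simp: e_def sgn_div_norm divide_simps)
      moreover have "(y s - v) \<bullet> e \<le> norm (y s - v)" for s
        using norm_cauchy_schwarz[of "y s - v" e] mult_left_mono[OF e norm_ge_zero, of "y s - v"] by simp
      moreover have "(y t - v) \<bullet> e = norm (y t - v)"
        by (simp add: e_def inner_sgn)
      ultimately show ?case
        by (intro impI exI[of _ "\<lambda>s. (y s - v) \<bullet> e"] exI[of _ "w t \<bullet> e"]) auto
    qed
  qed
  then show ?thesis
    using assms(2) by (simp add: measure_restrict_space mult.commute)
qed

text \<open>Almost everywhere \<open>w s \<bullet> (y s - v)\<close> is the derivative of half the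
  squared distance, so the bound on \<open>p\<close> integrates explicitly; \<open>F\<close> serves
  as its own touching function.\<close>

lemma integral_le_distance_decrease:
  assumes ab: "0 \<le> a" "a \<le> b" and p: "integrable (lebesgue_on {a..b}) p"
    and le: "\<And>s. s \<in> {a..b} \<Longrightarrow> p s \<le> - (w s \<bullet> (y s - v)) + c + k * s"
  shows "(LINT s|lebesgue_on {a..b}. p s)
    \<le> (norm (y a - v))\<^sup>2 / 2 - (norm (y b - v))\<^sup>2 / 2 + c * (b - a) + k / 2 * (b\<^sup>2 - a\<^sup>2)"
proof -
  have sub: "{a..b} \<subseteq> {0..}"
    using ab by auto
  have ylip: "(L + 0)-lipschitz_on {a..b} (\<lambda>s. y s - v)"
    by (intro lipschitz_intros lipschitz_on_subset[OF lip sub])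
  obtain K1 where K1: "K1-lipschitz_on {a..b} (\<lambda>s. (y s - v) \<bullet> (y s - v))"
    using lipschitz_on_inner_compact[OF compact_Icc ylip ylip] by blast
  obtain K2 where K2: "K2-lipschitz_on {a..b} (\<lambda>s::real. s \<bullet> s)"
    using lipschitz_on_inner_compact[OF compact_Icc lipschitz_on_id lipschitz_on_id] by blast
  define r where "r s = (y s - v) \<bullet> (y s - v)" for s
  define F where "F s = (1/2) * r s - c * s - k/2 * (s \<bullet> s)" for s
  have Flip: "(\<bar>1/2\<bar> * K1 + \<bar>c\<bar> * 1 + \<bar>k/2\<bar> * K2)-lipschitz_on {a..b} F"
    unfolding F_def r_def by (intro lipschitz_on_diff K1 lipschitz_on_cmult_real K2 lipschitz_on_id)
  have "F b - F a \<le> (LINT s|lebesgue_on {a..b}. - p s)"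
  proof (rule lipschitz_increment_le_integral[OF ab(2) Flip])
    show "AE t in lebesgue_on {a..b}. a < t \<longrightarrow>
      (\<exists>G d. G t = F t \<and> (\<forall>s\<in>{a..t}. G s \<le> F s) \<and>
        (G has_real_derivative d) (at t within {a..t}) \<and> d \<le> - p t)"
      using AE_derivative[OF ab(1), of b] AE_space
    proof eventually_elim
      case (elim t)
      then have t: "t \<in> {a..b}" and der: "(y has_vector_derivative w t) (at t within {a..t})"
        by auto
      have "(F has_real_derivative (w t \<bullet> (y t - v) - c - k * t)) (at t within {a..t})"
        using der unfolding F_def r_def has_real_derivative_iff_has_vector_derivative has_vector_derivative_def
        by (auto intro!: derivative_eq_intros simp: algebra_simps inner_commute)
      then show ?case
        using le[OF t] by (intro impI exI[of _ F] exI[of _ "w t \<bullet> (y t - v) - c - k * t"]) auto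
    qed
  qed (use p in simp)
  then have "(LINT s|lebesgue_on {a..b}. p s) \<le> r a / 2 - r b / 2 + c * (b - a) + k / 2 * (b\<^sup>2 - a\<^sup>2)"
    by (simp add: F_def power2_eq_square algebra_simps)
  then show ?thesis
    by (simp add: r_def power2_norm_eq_inner)
qed

end

section \<open>Convergence rates\<close>

theorem mainTheorem1:
  fixes A :: "real ^ 'p \<Rightarrow> real ^ 'd"
    and J :: "real ^ 'p \<Rightarrow> ereal"
    and f f\<^sub>\<delta> ybar :: "real ^ 'd"
    and xbar :: "real ^ 'p"
    and \<delta> C\<^sub>0 :: real
    and x :: "real \<Rightarrow> real ^ 'p"
    and y :: "real \<Rightarrow> real ^ 'd"
  assumes "linear A"
    and "proper_fun J" and "convex_ereal J" and "lower_semicontinuous J"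
    and "- adjoint A ybar \<in> subdifferential J xbar"
    and "A xbar = f"
    and "\<delta> \<ge> 0"
    and "norm (f\<^sub>\<delta> - f) \<le> \<delta>"
    and chain_rule: "\<And>v. subdifferential (\<lambda>w. fenchel_conj J (- adjoint A w)) v
           = (\<lambda>z. - A z) ` subdifferential (fenchel_conj J) (- adjoint A v)"
    and flow: "dual_subgradient_flow J A f\<^sub>\<delta> x y"
    and C\<^sub>0: "C\<^sub>0 = norm (y 0 - ybar)"
  shows "\<forall>t>0.
      bregman J (- adjoint A ybar) (tail_average x t) xbar
        \<le> ereal (C\<^sub>0\<^sup>2 / t + 2 * C\<^sub>0 * \<delta> + \<delta>\<^sup>2 * t)
    \<and> (norm (A (tail_average x t) - f))\<^sup>2
        \<le> 2 * C\<^sub>0\<^sup>2 / t\<^sup>2 + 6 * C\<^sub>0 * (\<delta> / t) + 6 * \<delta>\<^sup>2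
    \<and> bregman J (- adjoint A (y t)) xbar (x t)
        \<le> ereal (C\<^sub>0\<^sup>2 / (2 * t) + 3 * C\<^sub>0 / 2 * \<delta> + 3 / 2 * \<delta>\<^sup>2 * t)"
proof (intro allI impI)
  fix t :: real assume t: "0 < t"

  \<comment> \<open>The dual objective along the flow\<close>
  define u where "u v = - adjoint A v" for v
  have u_inner: "u v \<bullet> z = - (v \<bullet> A z)" "z \<bullet> u v = - (v \<bullet> A z)" for v z
    using adjoint_works[OF assms(1), of z v] by (auto simp: u_def inner_commute)
  have u_bl: "bounded_linear u"
    unfolding u_def by (intro linear_conv_bounded_linear[THEN iffD1] linear_compose_neg adjoint_linear assms)
  have A_bl: "bounded_linear A"
    using assms(1) by (simp add: linear_conv_bounded_linear)
  obtain L where lip: "L-lipschitz_on {0..} y"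
    and sub: "\<And>s. 0 \<le> s \<Longrightarrow> x s \<in> subdifferential (fenchel_conj J) (u (y s))"
    and deriv: "AE s in lebesgue. 0 \<le> s \<longrightarrow> (y has_vector_derivative (A (x s) - f\<^sub>\<delta>)) (at s within {0..})"
    and meas: "x \<in> borel_measurable (lebesgue_on {0..})"
    and int: "\<And>a b. 0 \<le> a \<Longrightarrow> set_integrable lebesgue {a..b} x"
    using flow unfolding dual_subgradient_flow_def u_def by blast
  have ybar: "u ybar \<in> subdifferential J xbar"
    using assms(5) by (simp add: u_def)
  then obtain j where j: "J xbar = ereal j"
    by (auto simp: subdifferential_def)
  have conj_ybar: "fenchel_conj J (u ybar) = ereal (- (ybar \<bullet> f) - j)"
    using fenchel_conj_subgradient[OF ybar] by (simp add: j u_inner assms(6))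
  \<comment> \<open>The subgradient \<open>x s\<close> makes the conjugate finite at
    \<open>u (y s)\<close>, so no default value of \<open>real_of_ereal\<close> enters for
    \<open>s \<ge> 0\<close>.\<close>
  define H where "H s = real_of_ereal (fenchel_conj J (u (y s)))" for s
  have H: "fenchel_conj J (u (y s)) = ereal (H s)" if "0 \<le> s" for s
    using sub[OF that] by (auto simp: subdifferential_def H_def ereal_real')
  have H_le: "ereal (H s + x s \<bullet> (z - u (y s))) \<le> fenchel_conj J z" if "0 \<le> s" for s z
    using sub[OF that] H[OF that] by (auto simp: subdifferential_def)
  \<comment> \<open>Weak duality: \<open>- j\<close> bounds the noise-free dual objective from
    below, and \<open>conj_ybar\<close> shows that \<open>ybar\<close> attains it.\<close>
  have H_ge: "- (y s \<bullet> f) - j \<le> H s" if "0 \<le> s" for s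
    using fenchel_young[of "u (y s)" xbar J] H[OF that] by (simp add: j u_inner assms(6))
  define w where "w s = A (x s) - f\<^sub>\<delta>" for s
  define \<Phi> where "\<Phi> s = H s + f\<^sub>\<delta> \<bullet> y s" for s
  define D where "D = - (ybar \<bullet> f) - j + f\<^sub>\<delta> \<bullet> ybar"
  \<comment> \<open>\<open>\<Phi>\<close> is the noisy dual objective along the flow, \<open>D\<close> its value at \<open>ybar\<close>.\<close>
  interpret subgradient_curve y w \<Phi> L
  proof
    show "AE s in lebesgue. 0 \<le> s \<longrightarrow> (y has_vector_derivative w s) (at s within {0..})"
      using deriv by (simp add: w_def)
    show "w \<in> borel_measurable (lebesgue_on {0..})"
      unfolding w_def using meas linear_continuous_on[OF A_bl]
      by (intro borel_measurable_diff borel_measurable_continuous_on[OF _ meas]) auto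
    show "\<Phi> s - w s \<bullet> (y r - y s) \<le> \<Phi> r" if "0 \<le> s" "0 \<le> r" for s r
      using H_le[OF that(1), of "u (y r)"] H[OF that(2)]
      by (simp add: \<Phi>_def w_def u_inner inner_diff_left inner_diff_right inner_commute)
    show "\<Phi> s \<le> d" if s: "0 \<le> s" and \<tau>: "\<And>n. 0 \<le> \<tau> n" "\<tau> \<longlonglongrightarrow> s" and c: "c \<longlonglongrightarrow> d" "\<And>n. \<Phi> (\<tau> n) \<le> c n" for s \<tau> c d
    proof -
      have ylim: "(\<lambda>n. y (\<tau> n)) \<longlonglongrightarrow> y s"
        using continuous_on_tendsto_compose[OF lipschitz_on_continuous_on[OF lip] \<tau>(2)] s \<tau>(1) by simp
      have "fenchel_conj J (u (y s)) \<le> ereal (d - f\<^sub>\<delta> \<bullet> y s)"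
      proof (rule fenchel_conj_limit_le[OF assms(2)])
        show "(\<lambda>n. u (y (\<tau> n))) \<longlonglongrightarrow> u (y s)"
          using bounded_linear.tendsto[OF u_bl ylim] .
        show "(\<lambda>n. c n - f\<^sub>\<delta> \<bullet> y (\<tau> n)) \<longlonglongrightarrow> d - f\<^sub>\<delta> \<bullet> y s"
          using c(1) ylim by (intro tendsto_intros)
        show "fenchel_conj J (u (y (\<tau> n))) \<le> ereal (c n - f\<^sub>\<delta> \<bullet> y (\<tau> n))" for n
          using c(2)[of n] H[OF \<tau>(1)] by (simp add: \<Phi>_def)
      qed
      then show ?thesis
        using H[OF s] by (simp add: \<Phi>_def)
    qed
  qed (rule lip)

  \<comment> \<open>Distance of the dual curve from \<open>ybar\<close>\<close>
  define r where "r s = norm (y s - ybar)" for s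
  have C0: "0 \<le> C\<^sub>0" "r 0 = C\<^sub>0"
    by (auto simp: C\<^sub>0 r_def)
  have \<Phi>_sub: "\<Phi> s - w s \<bullet> (ybar - y s) \<le> D" if "0 \<le> s" for s
    using H_le[OF that, of "u ybar"]
    by (simp add: conj_ybar D_def \<Phi>_def w_def u_inner inner_diff_left inner_diff_right inner_commute)
  have noise: "\<bar>(f\<^sub>\<delta> - f) \<bullet> v\<bar> \<le> \<delta> * norm v" for v
    using Cauchy_Schwarz_ineq2[of "f\<^sub>\<delta> - f" v] mult_right_mono[OF assms(8), of "norm v"] by simp
  \<comment> \<open>Since \<open>ybar\<close> minimizes the noise-free objective, only the noise
    term can push \<open>\<Phi>\<close> below \<open>D\<close>.\<close>
  have \<Phi>_ge: "- (\<delta> * r s) \<le> \<Phi> s - D" if "0 \<le> s" for s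
    using H_ge[OF that] noise[of "y s - ybar"]
    by (simp add: D_def \<Phi>_def r_def inner_diff_left inner_diff_right inner_commute)
  have r_le: "r s \<le> C\<^sub>0 + \<delta> * s" if "0 \<le> s" for s
  proof -
    have "w \<sigma> \<bullet> (y \<sigma> - ybar) \<le> \<delta> * norm (y \<sigma> - ybar)" if "0 \<le> \<sigma>" for \<sigma>
      using \<Phi>_sub[OF that] \<Phi>_ge[OF that] by (simp add: r_def inner_diff_right)
    from distance_growth[OF order_refl that assms(7) this] show ?thesis
      by (simp add: r_def C\<^sub>0)
  qed

  \<comment> \<open>Weighted residual and dual gap\<close>
  define S where "S = (LINT s|lebesgue_on {t/2..t}. s * (norm (w s))\<^sup>2)"
  have lyapunov: "t * (\<Phi> t - D) + (r t)\<^sup>2 / 2 + S \<le> C\<^sub>0\<^sup>2 / 2"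
  proof -
    \<comment> \<open>The Lyapunov estimate is split at \<open>t/2\<close>, and the nonnegative
      contribution of the first half is dropped.\<close>
    have "0 \<le> (LINT s|lebesgue_on {0..t/2}. s * (norm (w s))\<^sup>2)"
      by (rule Bochner_Integration.integral_nonneg) simp
    then show ?thesis
      using lyapunov_decrease[of 0 "t/2" ybar D] lyapunov_decrease[of "t/2" t ybar D] \<Phi>_sub t
      by (simp add: S_def r_def C\<^sub>0)
  qed
  have S_nonneg: "0 \<le> S"
    unfolding S_def using t by (intro Bochner_Integration.integral_nonneg) simp
  \<comment> \<open>The weights are chosen so that the Lyapunov term
    \<open>(r t)\<^sup>2 / 2\<close> absorbs the first summand.\<close>
  have young: "t * \<delta> * r t \<le> (r t)\<^sup>2 / 2 + t\<^sup>2 * \<delta>\<^sup>2 / 2"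
    using sum_squares_bound[of "t * \<delta>" "r t"] by (simp add: power_mult_distrib)
  have S_le: "S \<le> C\<^sub>0\<^sup>2 / 2 + t\<^sup>2 * \<delta>\<^sup>2 / 2"
  proof -
    have "t * (- (\<delta> * r t)) \<le> t * (\<Phi> t - D)"
      using \<Phi>_ge[of t] t by (intro mult_left_mono) auto
    then show ?thesis
      using lyapunov young by (simp add: algebra_simps)
  qed
  \<comment> \<open>The left-hand side is the noise-free dual gap at \<open>y t\<close>; it differs
    from \<open>\<Phi> t - D\<close> by a noise term of size at most
    \<open>\<delta> * r t\<close>.\<close>
  have gap: "H t + j + y t \<bullet> f \<le> C\<^sub>0\<^sup>2 / (2 * t) + t * \<delta>\<^sup>2 / 2"
  proof -
    have "H t + j + y t \<bullet> f = (\<Phi> t - D) - (f\<^sub>\<delta> - f) \<bullet> (y t - ybar)"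
      by (simp add: \<Phi>_def D_def inner_diff_left inner_diff_right inner_commute)
    also have "\<dots> \<le> (\<Phi> t - D) + \<delta> * r t"
      using noise[of "y t - ybar"] by (simp add: r_def)
    finally have "t * (H t + j + y t \<bullet> f) \<le> t * ((\<Phi> t - D) + \<delta> * r t)"
      using t by (intro mult_left_mono) auto
    also have "\<dots> \<le> C\<^sub>0\<^sup>2 / 2 + t\<^sup>2 * \<delta>\<^sup>2 / 2"
      using lyapunov young S_nonneg by (simp add: algebra_simps)
    finally show ?thesis
      using t by (simp add: field_simps power2_eq_square)
  qed

  \<comment> \<open>Averaging over the second half and the averaged residual\<close>
  have x_int: "integrable (lebesgue_on {t/2..t}) x"
    using int[of "t/2" t] t by (simp add: set_integrable_def integrable_restrict_space)
  have avg: "tail_average x t = (2 / t) *\<^sub>R (LINT s|lebesgue_on {t/2..t}. x s)"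
    by (simp add: tail_average_def set_lebesgue_integral_def integral_restrict_space)
  have const_int: "integrable (lebesgue_on {t/2..t}) (\<lambda>s. k)" for k :: "'z::euclidean_space"
    by (intro continuous_imp_integrable_real continuous_intros)
  have measure_half: "measure (lebesgue_on {t/2..t}) {t/2..t} = t/2"
    using t by (simp add: measure_restrict_space)
  have const_integral: "(LINT s|lebesgue_on {t/2..t}. k) = (t/2) *\<^sub>R k" for k :: "'z::euclidean_space"
    by (simp add: measure_half)
  have avg_inner: "(2 / t) * (LINT s|lebesgue_on {t/2..t}. x s \<bullet> z) = tail_average x t \<bullet> z" for z
    using x_int by (simp add: avg)
  have residual: "(norm (A (tail_average x t) - f\<^sub>\<delta>))\<^sup>2 \<le> 4 / t\<^sup>2 * S"
  proof -
    define m where "m = A (tail_average x t) - f\<^sub>\<delta>"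
    have w_int: "integrable (lebesgue_on {t/2..t}) w"
      unfolding w_def
      by (intro Bochner_Integration.integrable_diff integrable_bounded_linear[OF A_bl] x_int const_int)
    have "(LINT s|lebesgue_on {t/2..t}. w s) = A (LINT s|lebesgue_on {t/2..t}. x s) - (t/2) *\<^sub>R f\<^sub>\<delta>"
      unfolding w_def using x_int A_bl
      by (subst Bochner_Integration.integral_diff)
        (auto intro: integrable_bounded_linear simp: integral_bounded_linear measure_half)
    also have "\<dots> = (t/2) *\<^sub>R m"
      using t by (simp add: m_def avg linear_cmul[OF assms(1)] scaleR_diff_right)
    finally have w_integral: "(LINT s|lebesgue_on {t/2..t}. w s) = (t/2) *\<^sub>R m" .
    \<comment> \<open>Jensen through the tangent of the squared norm at the mean \<open>m\<close>;
      the weight enters because \<open>2 * s / t \<ge> 1\<close> on this interval.\<close>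
    have le: "2 * (w s \<bullet> m) - (norm m)\<^sup>2 \<le> 2 / t * (s * (norm (w s))\<^sup>2)" if "s \<in> {t/2..t}" for s
    proof -
      have "0 \<le> (norm (w s - m))\<^sup>2"
        by simp
      then have "2 * (w s \<bullet> m) - (norm m)\<^sup>2 \<le> 1 * (norm (w s))\<^sup>2"
        by (simp add: power2_norm_eq_inner inner_diff_left inner_diff_right inner_commute)
      also have "\<dots> \<le> (2 / t * s) * (norm (w s))\<^sup>2"
        using that t by (intro mult_right_mono) (auto simp: field_simps)
      finally show ?thesis
        by (simp add: mult.assoc)
    qed
    have "t / 2 * (norm m)\<^sup>2 = (LINT s|lebesgue_on {t/2..t}. 2 * (w s \<bullet> m) - (norm m)\<^sup>2)"
      using w_int by (simp add: const_int const_integral w_integral power2_norm_eq_inner measure_half)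
    also have "\<dots> \<le> (LINT s|lebesgue_on {t/2..t}. 2 / t * (s * (norm (w s))\<^sup>2))"
    proof (rule integral_mono)
      show "integrable (lebesgue_on {t/2..t}) (\<lambda>s. 2 * (w s \<bullet> m) - (norm m)\<^sup>2)"
        using w_int const_int by (intro Bochner_Integration.integrable_diff integrable_mult_right integrable_inner_left) auto
      show "integrable (lebesgue_on {t/2..t}) (\<lambda>s. 2 / t * (s * (norm (w s))\<^sup>2))"
        using t by (intro integrable_mult_right integrable_weighted_speed) auto
    qed (use le in auto)
    also have "\<dots> = 2 / t * S"
      by (simp add: S_def)
    finally show ?thesis
      using t by (simp add: m_def field_simps power2_eq_square)
  qed
  have residual': "(norm (A (tail_average x t) - f))\<^sup>2 \<le> 2 * C\<^sub>0\<^sup>2 / t\<^sup>2 + 6 * C\<^sub>0 * (\<delta> / t) + 6 * \<delta>\<^sup>2"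
  proof -
    define X where "X = norm (A (tail_average x t) - f\<^sub>\<delta>)"
    define c where "c = C\<^sub>0 / t"
    have c: "0 \<le> c"
      using C0 t by (simp add: c_def)
    have "X\<^sup>2 \<le> 4 / t\<^sup>2 * (C\<^sub>0\<^sup>2 / 2 + t\<^sup>2 * \<delta>\<^sup>2 / 2)"
      using residual mult_left_mono[OF S_le, of "4 / t\<^sup>2"] by (simp add: X_def)
    also have "\<dots> = 2 * c\<^sup>2 + 2 * \<delta>\<^sup>2"
      using t by (simp add: c_def field_simps)
    finally have X2: "X\<^sup>2 \<le> 2 * c\<^sup>2 + 2 * \<delta>\<^sup>2" .
    \<comment> \<open>As \<open>9/4 \<ge> 2\<close>, this rational bound avoids square roots. The
      coefficient of \<open>\<delta>\<^sup>2\<close> below then adds up to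
      \<open>2 + 3 + 1 = 6\<close>.\<close>
    have "X\<^sup>2 \<le> (3/2 * (c + \<delta>))\<^sup>2"
    proof -
      have "(3/2 * (c + \<delta>))\<^sup>2 = 9/4 * c\<^sup>2 + 9/2 * (c * \<delta>) + 9/4 * \<delta>\<^sup>2"
        by (simp add: power2_eq_square algebra_simps)
      then show ?thesis
        using X2 mult_nonneg_nonneg[OF c assms(7)] zero_le_power2[of c] zero_le_power2[of \<delta>] by linarith
    qed
    then have X: "X \<le> 3/2 * (c + \<delta>)"
      by (rule power2_le_imp_le) (use c assms(7) in simp)
    have "norm (A (tail_average x t) - f) \<le> X + \<delta>"
      using norm_triangle_ineq[of "A (tail_average x t) - f\<^sub>\<delta>" "f\<^sub>\<delta> - f"] assms(8) by (simp add: X_def)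
    then have "(norm (A (tail_average x t) - f))\<^sup>2 \<le> (X + \<delta>)\<^sup>2"
      by (intro power_mono) auto
    also have "\<dots> = X\<^sup>2 + 2 * \<delta> * X + \<delta>\<^sup>2"
      by (simp add: power2_eq_square algebra_simps)
    also have "\<dots> \<le> 2 * c\<^sup>2 + 2 * \<delta>\<^sup>2 + 2 * \<delta> * (3/2 * (c + \<delta>)) + \<delta>\<^sup>2"
      using X2 X assms(7) by (intro add_mono mult_left_mono) auto
    also have "\<dots> \<le> 2 * c\<^sup>2 + 6 * (c * \<delta>) + 6 * \<delta>\<^sup>2"
      using mult_nonneg_nonneg[OF c assms(7)] by (simp add: power2_eq_square algebra_simps)
    finally show ?thesis
      by (simp add: c_def power_divide)
  qed

  \<comment> \<open>Bregman distance at the current iterate\<close>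
  have bregman_x: "bregman J (u (y t)) xbar (x t) \<le> ereal (C\<^sub>0\<^sup>2 / (2 * t) + 3 * C\<^sub>0 / 2 * \<delta> + 3 / 2 * \<delta>\<^sup>2 * t)"
  proof -
    \<comment> \<open>Fenchel-Young at \<open>x t\<close> bounds the divergence by the noise-free
      dual gap.\<close>
    have "bregman J (u (y t)) xbar (x t) \<le> ereal (H t + j + y t \<bullet> f)"
      using fenchel_young[of "u (y t)" "x t" J] H[of t] t unfolding bregman_def
      by (cases "J (x t)") (auto simp: j u_inner inner_diff_right assms(6))
    also have "\<dots> \<le> ereal (C\<^sub>0\<^sup>2 / (2 * t) + 3 * C\<^sub>0 / 2 * \<delta> + 3 / 2 * \<delta>\<^sup>2 * t)"
    proof -
      have "0 \<le> C\<^sub>0 * \<delta>" "0 \<le> t * \<delta>\<^sup>2"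
        using C0 assms(7) t by auto
      then show ?thesis
        using gap by (simp add: algebra_simps)
    qed
    finally show ?thesis .
  qed

  \<comment> \<open>Bregman distance at the averaged iterate\<close>
  have bregman_avg: "bregman J (u ybar) (tail_average x t) xbar \<le> ereal (C\<^sub>0\<^sup>2 / t + 2 * C\<^sub>0 * \<delta> + \<delta>\<^sup>2 * t)"
  proof -
    \<comment> \<open>This takes the place of \<open>J (x s)\<close>: by \<open>H_le\<close> it
      dominates every affine piece of the biconjugate at \<open>x s\<close>, and its integrability
      follows from that of \<open>w s \<bullet> y s\<close> and \<open>\<Phi>\<close>.\<close>
    define m where "m s = x s \<bullet> u (y s) - H s" for s
    have ycont: "continuous_on {t/2..t} y"
      using continuous_on_subset[OF lipschitz_on_continuous_on[OF lip]] t by auto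
    have "continuous_on {t/2..t} \<Phi>"
      using continuous_on_subset[OF lipschitz_on_continuous_on[OF energy_lipschitz]] t by auto
    then have m_int: "integrable (lebesgue_on {t/2..t}) m"
    proof -
      have "m = (\<lambda>s. - (w s \<bullet> y s) - \<Phi> s)"
        by (auto simp: m_def w_def \<Phi>_def u_inner inner_diff_right inner_commute)
      moreover have "integrable (lebesgue_on {t/2..t}) (\<lambda>s. - (w s \<bullet> y s) - \<Phi> s)"
        using \<open>continuous_on {t/2..t} \<Phi>\<close> t
        by (intro Bochner_Integration.integrable_diff integrable_minus integrable_derivative_product
            ycont continuous_imp_integrable_real) auto
      ultimately show ?thesis
        by simp
    qed
    define M where "M = (LINT s|lebesgue_on {t/2..t}. m s)"
    have "J (tail_average x t) \<le> fenchel_conj (fenchel_conj J) (tail_average x t)"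
      by (rule fenchel_moreau_le[OF assms(2-4)])
    also have "\<dots> \<le> ereal (2 / t * M)"
      unfolding fenchel_conj_def[of "fenchel_conj J"]
    proof (rule SUP_least)
      fix z
      show "ereal (tail_average x t \<bullet> z) - fenchel_conj J z \<le> ereal (2 / t * M)"
      proof (cases "fenchel_conj J z")
        case (real k)
        have "(LINT s|lebesgue_on {t/2..t}. x s \<bullet> z - k) \<le> M"
          unfolding M_def
        proof (rule integral_mono)
          show "integrable (lebesgue_on {t/2..t}) (\<lambda>s. x s \<bullet> z - k)"
            using x_int const_int by (intro Bochner_Integration.integrable_diff integrable_inner_left) auto
          show "x s \<bullet> z - k \<le> m s" if "s \<in> space (lebesgue_on {t/2..t})" for s
            using H_le[of s z] that t by (auto simp: real m_def inner_diff_right)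
        qed (rule m_int)
        then have "(2 / t) * (LINT s|lebesgue_on {t/2..t}. x s \<bullet> z - k) \<le> 2 / t * M"
          using t by (intro mult_left_mono) auto
        moreover have "(LINT s|lebesgue_on {t/2..t}. x s \<bullet> z - k) = (LINT s|lebesgue_on {t/2..t}. x s \<bullet> z) - t / 2 * k"
          using x_int const_int const_integral[of k] by (subst Bochner_Integration.integral_diff) auto
        ultimately show ?thesis
          using avg_inner[of z] t by (simp add: real right_diff_distrib)
      \<comment> \<open>The subgradient inequality at time \<open>0\<close> rules out the value
        \<open>-\<infinity>\<close> of the conjugate.\<close>
      qed (use H_le[of 0 z] in auto)
    qed
    finally have J_le: "J (tail_average x t) \<le> ereal (2 / t * M)" .
    \<comment> \<open>The divergence of \<open>x s\<close> from \<open>xbar\<close> with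
      \<open>m s\<close> in place of \<open>J (x s)\<close>.\<close>
    define p where "p s = m s - x s \<bullet> u ybar - (j + ybar \<bullet> f)" for s
    have p_int: "integrable (lebesgue_on {t/2..t}) p"
      unfolding p_def using x_int const_int m_int
      by (intro Bochner_Integration.integrable_diff integrable_inner_left) auto
    have p_integral: "2 / t * (LINT s|lebesgue_on {t/2..t}. p s)
        = 2 / t * M - tail_average x t \<bullet> u ybar - (j + ybar \<bullet> f)"
    proof -
      have "(LINT s|lebesgue_on {t/2..t}. p s) = M - (LINT s|lebesgue_on {t/2..t}. x s \<bullet> u ybar) - t / 2 * (j + ybar \<bullet> f)"
        unfolding p_def M_def using x_int const_int[of "j + ybar \<bullet> f"] const_integral[of "j + ybar \<bullet> f"] m_int
        by (subst Bochner_Integration.integral_diff) (auto intro!: Bochner_Integration.integral_diff)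
      then show ?thesis
        using avg_inner[of "u ybar"] t by (simp add: right_diff_distrib add_divide_distrib)
    qed
    have "p s \<le> - (w s \<bullet> (y s - ybar)) + \<delta> * C\<^sub>0 + \<delta>\<^sup>2 * s" if "s \<in> {t/2..t}" for s
    proof -
      have s: "0 \<le> s"
        using that t by simp
      have "p s = - (A (x s) \<bullet> (y s - ybar)) - H s - j - ybar \<bullet> f"
        by (simp add: p_def m_def u_inner inner_diff_right inner_commute)
      \<comment> \<open>Weak duality trades \<open>- H s - j\<close> for
        \<open>y s \<bullet> f\<close>, leaving \<open>A (x s) - f\<close>, that is
        \<open>w s\<close> plus noise, tested against \<open>y s - ybar\<close>.\<close>
      also have "\<dots> \<le> - (w s \<bullet> (y s - ybar)) - (f\<^sub>\<delta> - f) \<bullet> (y s - ybar)"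
        using H_ge[OF s] by (simp add: w_def inner_diff_left inner_diff_right inner_commute)
      also have "\<dots> \<le> - (w s \<bullet> (y s - ybar)) + \<delta> * r s"
        using noise[of "y s - ybar"] by (simp add: r_def)
      also have "\<dots> \<le> - (w s \<bullet> (y s - ybar)) + \<delta> * (C\<^sub>0 + \<delta> * s)"
        using r_le[OF s] assms(7) by (intro add_left_mono mult_left_mono)
      finally show ?thesis
        by (simp add: power2_eq_square algebra_simps)
    qed
    from integral_le_distance_decrease[OF _ _ p_int this]
    have "(LINT s|lebesgue_on {t/2..t}. p s)
        \<le> (r (t/2))\<^sup>2 / 2 - (r t)\<^sup>2 / 2 + \<delta> * C\<^sub>0 * (t - t/2) + \<delta>\<^sup>2 / 2 * (t\<^sup>2 - (t/2)\<^sup>2)"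
      using t by (simp add: r_def)
    \<comment> \<open>The distance at \<open>t/2\<close> is controlled by the growth bound and the
      one at \<open>t\<close> is discarded; the sum is then exactly \<open>t / 2\<close> times the
      claimed rate.\<close>
    also have "\<dots> \<le> (C\<^sub>0 + \<delta> * (t/2))\<^sup>2 / 2 - 0 + \<delta> * C\<^sub>0 * (t - t/2) + \<delta>\<^sup>2 / 2 * (t\<^sup>2 - (t/2)\<^sup>2)"
      using r_le[of "t/2"] t by (intro add_mono diff_mono divide_right_mono power_mono) (auto simp: r_def)
    also have "\<dots> = t / 2 * (C\<^sub>0\<^sup>2 / t + 2 * C\<^sub>0 * \<delta> + \<delta>\<^sup>2 * t)"
      using t by (simp add: field_simps power2_eq_square)
    finally have "(LINT s|lebesgue_on {t/2..t}. p s) \<le> t / 2 * (C\<^sub>0\<^sup>2 / t + 2 * C\<^sub>0 * \<delta> + \<delta>\<^sup>2 * t)" .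
    moreover have "2 / t * P \<le> Q" if "P \<le> t / 2 * Q" for P Q
      using that t by (simp add: field_simps)
    ultimately have "2 / t * M - tail_average x t \<bullet> u ybar - (j + ybar \<bullet> f)
        \<le> C\<^sub>0\<^sup>2 / t + 2 * C\<^sub>0 * \<delta> + \<delta>\<^sup>2 * t"
      unfolding p_integral[symmetric] by blast
    then show ?thesis
      using J_le unfolding bregman_def
      by (cases "J (tail_average x t)") (auto simp: j u_inner inner_diff_right assms(6))
  qed
  from bregman_avg residual' bregman_x
  show "bregman J (- adjoint A ybar) (tail_average x t) xbar
        \<le> ereal (C\<^sub>0\<^sup>2 / t + 2 * C\<^sub>0 * \<delta> + \<delta>\<^sup>2 * t)
    \<and> (norm (A (tail_average x t) - f))\<^sup>2
        \<le> 2 * C\<^sub>0\<^sup>2 / t\<^sup>2 + 6 * C\<^sub>0 * (\<delta> / t) + 6 * \<delta>\<^sup>2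
    \<and> bregman J (- adjoint A (y t)) xbar (x t)
        \<le> ereal (C\<^sub>0\<^sup>2 / (2 * t) + 3 * C\<^sub>0 / 2 * \<delta> + 3 / 2 * \<delta>\<^sup>2 * t)"
    by (simp add: u_def)
qed

end
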